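(* Let $S$ be a closed $\Sigma$-formula and $A(x)$ an arbitrary formula. Then the formula \[ \Big(\big(\forall x\,(A(x)\vee(A(x)\to S))\big)\to S\Big)\to S \] is provable (with an unmarked sequent $\vdash$) in the system $\mathrm{MQC}^+_S$.
   Context: $\mathrm{MQC}^+_S$, parameterized by a closed $\Sigma$-formula $S$, is the following natural deduction system. Judgements are sequents $\Gamma\vdash A$ (unmarked) or $\Gamma\vdash_S A$ (marked). All usual rules of minimal intuitionistic predicate logic (axiom, introduction and elimination for $\wedge,\vee,\to,\forall,\exists$; no ex falso rule) are allowed in both forms, with the same marker (unmarked or marked) in all premises and conclusion. Two additional rules: reset: from $\Gamma\vdash_S S$ infer $\Gamma\vdash S$ (and also from $\Gamma\vdash_S S$ infer $\Gamma\vdash_S S$); shift: from $\Gamma, A\to S\vdash_S S$ infer $\Gamma\vdash_S A$, for any formula $A$. A formula is provable if it is derivable as $\vdash$ with empty context. A $\Sigma$-formula is one built only from existential quantifiers (over natural numbers), disjunction, conjunction and equality atoms; in pure predicate logic these are the formulas containing no $\forall$ and no $\to$. *)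

theory Defs
  imports Main
begin

text \<open>
  First-order syntax with de Bruijn indices, so that formulas are taken up to renaming of bound
  variables. There is no primitive falsum: in minimal logic it has no rules and is an ordinary
  nullary predicate symbol. Equality likewise is one of the predicate symbols.
\<close>

datatype 'f tm = Var nat | Fn 'f "'f tm list"

datatype ('f, 'p) fm =
    Atom 'p "'f tm list"
  | Conj "('f, 'p) fm" "('f, 'p) fm"
  | Disj "('f, 'p) fm" "('f, 'p) fm"
  | Imp "('f, 'p) fm" "('f, 'p) fm"
  | Forall "('f, 'p) fm"
  | Exists "('f, 'p) fm"

primrec fv_tm :: "'f tm \<Rightarrow> nat set" where
  "fv_tm (Var n) = {n}"
| "fv_tm (Fn f ts) = \<Union> (set (map fv_tm ts))"

primrec fv :: "('f, 'p) fm \<Rightarrow> nat set" where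
  "fv (Atom p ts) = \<Union> (set (map fv_tm ts))"
| "fv (Conj A B) = fv A \<union> fv B"
| "fv (Disj A B) = fv A \<union> fv B"
| "fv (Imp A B) = fv A \<union> fv B"
| "fv (Forall A) = {n. Suc n \<in> fv A}"
| "fv (Exists A) = {n. Suc n \<in> fv A}"

definition closed_fm :: "('f, 'p) fm \<Rightarrow> bool" where
  "closed_fm A \<longleftrightarrow> fv A = {}"

primrec sigma_fm :: "('f, 'p) fm \<Rightarrow> bool" where
  "sigma_fm (Atom p ts) \<longleftrightarrow> True"
| "sigma_fm (Conj A B) \<longleftrightarrow> sigma_fm A \<and> sigma_fm B"
| "sigma_fm (Disj A B) \<longleftrightarrow> sigma_fm A \<and> sigma_fm B"
| "sigma_fm (Imp A B) \<longleftrightarrow> False"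
| "sigma_fm (Forall A) \<longleftrightarrow> False"
| "sigma_fm (Exists A) \<longleftrightarrow> sigma_fm A"

primrec subst_tm :: "(nat \<Rightarrow> 'f tm) \<Rightarrow> 'f tm \<Rightarrow> 'f tm" where
  "subst_tm \<sigma> (Var n) = \<sigma> n"
| "subst_tm \<sigma> (Fn f ts) = Fn f (map (subst_tm \<sigma>) ts)"

text \<open>The substitution \<open>\<sigma>\<close> carried under one binder.\<close>

definition up :: "(nat \<Rightarrow> 'f tm) \<Rightarrow> nat \<Rightarrow> 'f tm" where
  "up \<sigma> = case_nat (Var 0) (\<lambda>n. subst_tm (\<lambda>i. Var (Suc i)) (\<sigma> n))"

primrec subst :: "(nat \<Rightarrow> 'f tm) \<Rightarrow> ('f, 'p) fm \<Rightarrow> ('f, 'p) fm" where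
  "subst \<sigma> (Atom p ts) = Atom p (map (subst_tm \<sigma>) ts)"
| "subst \<sigma> (Conj A B) = Conj (subst \<sigma> A) (subst \<sigma> B)"
| "subst \<sigma> (Disj A B) = Disj (subst \<sigma> A) (subst \<sigma> B)"
| "subst \<sigma> (Imp A B) = Imp (subst \<sigma> A) (subst \<sigma> B)"
| "subst \<sigma> (Forall A) = Forall (subst (up \<sigma>) A)"
| "subst \<sigma> (Exists A) = Exists (subst (up \<sigma>) A)"

definition lift :: "('f, 'p) fm \<Rightarrow> ('f, 'p) fm" where
  "lift A = subst (\<lambda>n. Var (Suc n)) A"

text \<open>\<open>A(t)\<close>, for \<open>A\<close> the body of a quantifier.\<close>

definition inst :: "('f, 'p) fm \<Rightarrow> 'f tm \<Rightarrow> ('f, 'p) fm" where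
  "inst A t = subst (case_nat t Var) A"

datatype marker = Unmarked | Marked

text \<open>
  \<open>deriv S Unmarked \<Gamma> A\<close> is the sequent \<open>\<Gamma> \<turnstile> A\<close> and \<open>deriv S Marked \<Gamma> A\<close> is
  \<open>\<Gamma> \<turnstile>\<^sub>S A\<close>. In the rules \<open>ForallI\<close> and \<open>ExistsE\<close> the eigenvariable is index 0, and lifting the context
  (and the conclusion of \<open>ExistsE\<close>) expresses that it does not occur free there. The
  parameter \<open>S\<close> itself is not lifted; this is the intended system because \<open>S\<close> is meant to be
  closed, see \<open>lift_closed\<close> below.
\<close>

inductive deriv :: "('f, 'p) fm \<Rightarrow> marker \<Rightarrow> ('f, 'p) fm list \<Rightarrow> ('f, 'p) fm \<Rightarrow> bool"
  for S :: "('f, 'p) fm" where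
  Ax: "A \<in> set \<Gamma> \<Longrightarrow> deriv S m \<Gamma> A"
| ConjI: "deriv S m \<Gamma> A \<Longrightarrow> deriv S m \<Gamma> B \<Longrightarrow> deriv S m \<Gamma> (Conj A B)"
| ConjE1: "deriv S m \<Gamma> (Conj A B) \<Longrightarrow> deriv S m \<Gamma> A"
| ConjE2: "deriv S m \<Gamma> (Conj A B) \<Longrightarrow> deriv S m \<Gamma> B"
| DisjI1: "deriv S m \<Gamma> A \<Longrightarrow> deriv S m \<Gamma> (Disj A B)"
| DisjI2: "deriv S m \<Gamma> B \<Longrightarrow> deriv S m \<Gamma> (Disj A B)"
| DisjE: "deriv S m \<Gamma> (Disj A B) \<Longrightarrow> deriv S m (A # \<Gamma>) C \<Longrightarrow> deriv S m (B # \<Gamma>) C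
    \<Longrightarrow> deriv S m \<Gamma> C"
| ImpI: "deriv S m (A # \<Gamma>) B \<Longrightarrow> deriv S m \<Gamma> (Imp A B)"
| ImpE: "deriv S m \<Gamma> (Imp A B) \<Longrightarrow> deriv S m \<Gamma> A \<Longrightarrow> deriv S m \<Gamma> B"
| ForallI: "deriv S m (map lift \<Gamma>) A \<Longrightarrow> deriv S m \<Gamma> (Forall A)"
| ForallE: "deriv S m \<Gamma> (Forall A) \<Longrightarrow> deriv S m \<Gamma> (inst A t)"
| ExistsI: "deriv S m \<Gamma> (inst A t) \<Longrightarrow> deriv S m \<Gamma> (Exists A)"
| ExistsE: "deriv S m \<Gamma> (Exists A) \<Longrightarrow> deriv S m (A # map lift \<Gamma>) (lift C) \<Longrightarrow> deriv S m \<Gamma> C"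
| Reset: "deriv S Marked \<Gamma> S \<Longrightarrow> deriv S m \<Gamma> S"
| Shift: "deriv S Marked (Imp A S # \<Gamma>) S \<Longrightarrow> deriv S Marked \<Gamma> A"

definition provable :: "('f, 'p) fm \<Rightarrow> ('f, 'p) fm \<Rightarrow> bool" where
  "provable S A \<longleftrightarrow> deriv S Unmarked [] A"

lemma subst_tm_id: "(\<And>n. n \<in> fv_tm t \<Longrightarrow> \<sigma> n = Var n) \<Longrightarrow> subst_tm \<sigma> t = t"
  by (induction t) (auto intro!: map_idI)

lemma subst_id: "(\<And>n. n \<in> fv A \<Longrightarrow> \<sigma> n = Var n) \<Longrightarrow> subst \<sigma> A = A"
proof (induction A arbitrary: \<sigma>)
  case (Atom p ts)
  then show ?case by (auto intro!: map_idI subst_tm_id)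
next
  case (Forall A)
  have "subst (up \<sigma>) A = A" by (intro Forall.IH) (auto simp: up_def Forall.prems split: nat.split)
  then show ?case by simp
next
  case (Exists A)
  have "subst (up \<sigma>) A = A" by (intro Exists.IH) (auto simp: up_def Exists.prems split: nat.split)
  then show ?case by simp
qed simp_all

lemma lift_closed: "closed_fm S \<Longrightarrow> lift S = S"
  unfolding lift_def closed_fm_def by (rule subst_id) simp

end

theory Submission
  imports Defs
begin

text \<open>
  By reset it suffices to work in the marked system, where \<open>\<forall>x (A(x) \<or> (A(x) \<rightarrow> S))\<close> is derivable
  outright: for a generic \<open>x\<close>, shift reduces the matrix \<open>D\<close> to deriving \<open>S\<close> from \<open>D \<rightarrow> S\<close>, which is
  the usual proof that excluded middle relative to \<open>S\<close> is not refutable.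
\<close>

text \<open>Membership in \<open>\<Gamma>\<close> replaces weakening: the implication is used twice,
  first under the extra assumption \<open>A\<close>, then in \<open>\<Gamma>\<close> itself.\<close>

lemma deriv_S_if_em_imp:
  assumes "Imp (Disj A (Imp A S)) S \<in> set \<Gamma>"
  shows "deriv S m \<Gamma> S"
proof -
  have "deriv S m (A # \<Gamma>) S"
  proof (rule ImpE)
    show "deriv S m (A # \<Gamma>) (Imp (Disj A (Imp A S)) S)"
      using assms by (intro Ax) simp
    show "deriv S m (A # \<Gamma>) (Disj A (Imp A S))"
      by (intro DisjI1 Ax) simp
  qed
  then have "deriv S m \<Gamma> (Disj A (Imp A S))"
    by (intro DisjI2 ImpI)
  with Ax[OF assms] show ?thesis
    by (rule ImpE)
qed

lemma deriv_Marked_em: "deriv S Marked \<Gamma> (Disj A (Imp A S))"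
  by (rule Shift, rule deriv_S_if_em_imp[of A]) simp

theorem theorem3:
  fixes S A :: "('f, 'p) fm"
  assumes "closed_fm S" and "sigma_fm S"
  shows "provable S (Imp (Imp (Forall (Disj A (Imp A S))) S) S)"
proof -
  let ?F = "Forall (Disj A (Imp A S))"
  have "deriv S Marked [Imp ?F S] S"
  proof (rule ImpE)
    show "deriv S Marked [Imp ?F S] (Imp ?F S)"
      by (rule Ax) simp
    show "deriv S Marked [Imp ?F S] ?F"
      \<comment> \<open>\<open>deriv_Marked_em\<close> holds in every context, hence in the lifted
        one. Under the binder \<open>S\<close> needs no shift of indices, being closed.\<close>
      by (rule ForallI[OF deriv_Marked_em])
  qed
  then show ?thesis
    \<comment> \<open>Once the antecedent is discharged the goal is \<open>S\<close> itself, so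
      reset applies.\<close>
    unfolding provable_def by (rule ImpI[OF Reset])
qed

end
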